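(* Let $n\ge 25$ be an integer. Then $$\left(n,\;1+\prod_{0\le i<3}\left\lfloor\frac{n+3+i}{3}\right\rfloor\right)\rightarrow(4,13);$$ that is, for every family $\mathcal{F}\subset 2^{[n]}$ with $|\mathcal{F}|\ge 1+\left\lfloor\frac{n+3}{3}\right\rfloor\left\lfloor\frac{n+4}{3}\right\rfloor\left\lfloor\frac{n+5}{3}\right\rfloor$ there exists a $4$-element set $Y\subset[n]$ such that $|\mathcal{F}_{\mid Y}|\ge 13$.
   Context: $[n]=\{1,2,\ldots,n\}$ and $2^{[n]}$ is its power set. For a family $\mathcal{F}\subset 2^{[n]}$ and $Y\subset[n]$, the trace of $\mathcal{F}$ on $Y$ is $\mathcal{F}_{\mid Y}=\{F\cap Y: F\in\mathcal{F}\}$ (a set of subsets of $Y$, counted without multiplicity). The arrow relation $(n,m)\rightarrow(a,b)$ means: for every $\mathcal{F}\subset 2^{[n]}$ with $|\mathcal{F}|\ge m$ there exists an $a$-element set $Y\subset[n]$ with $|\mathcal{F}_{\mid Y}|\ge b$. *)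

theory Defs
  imports Main
begin

definition trace :: "'a set set \<Rightarrow> 'a set \<Rightarrow> 'a set set" where
  "trace \<F> Y = {F \<inter> Y | F. F \<in> \<F>}"

definition arrow :: "nat \<Rightarrow> nat \<Rightarrow> nat \<Rightarrow> nat \<Rightarrow> bool" where
  "arrow n m a b \<longleftrightarrow>
     (\<forall>\<F>. \<F> \<subseteq> Pow {1..n} \<and> card \<F> \<ge> m \<longrightarrow>
        (\<exists>Y. Y \<subseteq> {1..n} \<and> card Y = a \<and> card (trace \<F> Y) \<ge> b))"

end

theory Submission
  imports Defs
begin

text \<open>
  Write \<open>box n\<close> for the product in the theorem. It counts the sets that meet each class of a
  balanced partition of an \<open>n\<close>-set into three classes in at most one element. Such sets have at
  most \<open>3 * 2 * 2 = 12\<close> traces on four points, and the point is that no larger family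
  has this property.

  Down-compression does not change the size of a family and never enlarges a trace
  (\<open>exists_hereditary_compression\<close>), so the family may be taken to be a simplicial complex.
  The trace of a complex on \<open>Y\<close> consists of its faces inside \<open>Y\<close>. If every four points span at
  most 12 faces, then faces have at most three elements, and two triples \<open>{a,b,u}\<close>, \<open>{a,b,v}\<close> never
  occur together with the edge \<open>{u,v}\<close>: otherwise \<open>{a,b,u,v}\<close> would span the empty face, four
  vertices, six edges and two triples. Such complexes are called cancellative here, after the
  cancellative triple systems of Bollobas.

  It remains to see that a cancellative complex on \<open>n\<close> vertices has at most \<open>box n\<close> faces
  (\<open>cancellative_card_le_box\<close>). This goes by induction on \<open>n\<close>: a set \<open>S\<close> of vertices is removed, and
  the faces that meet \<open>S\<close> are counted according to the part \<open>G\<close> that lies outside \<open>S\<close>.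

  The main case is that \<open>S\<close> is a triple of the complex. There are at most 7 such faces with \<open>G\<close>
  empty, at most 3 for every single vertex, and at most 1 for every pair: if \<open>u\<close> and \<open>u'\<close> in \<open>S\<close> both
  formed a triple with \<open>G\<close>, the edge \<open>{u,u'}\<close> would be forbidden. With \<open>m = n - 3\<close>, the sum
  \<open>7 + 3 * m + m^2 div 3\<close> is exactly \<open>box n - box m\<close>, so it suffices that at most \<open>m^2 div 3\<close> pairs
  contribute. By Turan's theorem this holds unless four vertices have all their six pairs
  contributing. Colour such a pair by the vertex of \<open>S\<close> that completes it to a triple. Two
  pairs that share a vertex get different colours, so each of the four vertices sees all three
  colours, and the four vertices and \<open>S\<close> together are seven pairwise adjacent vertices
  (\<open>K4_in_link_gives_K7\<close>). The Fano plane shows that this can happen.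

  But seven pairwise adjacent vertices can themselves be removed. Triples inside them share
  at most one vertex, so there are at most 7, and similarly few faces reach outside;
  the loss is at most \<open>35 + 10 * m + (m choose 2)\<close> with \<open>m = n - 7\<close>, which does not
  exceed \<open>box n - box m\<close>. If finally there are no triples, a single vertex is removed.
\<close>

section \<open>Down-compression\<close>

definition hereditary :: "'a set set \<Rightarrow> bool" where
  "hereditary K \<longleftrightarrow> (\<forall>A\<in>K. \<forall>B. B \<subseteq> A \<longrightarrow> B \<in> K)"

definition shift_set :: "'a \<Rightarrow> 'a set set \<Rightarrow> 'a set \<Rightarrow> 'a set" where
  "shift_set i F A = (if i \<in> A \<and> A - {i} \<notin> F then A - {i} else A)"

lemma shift_set_subset: "shift_set i F A \<subseteq> A"
  by (auto simp: shift_set_def)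

lemma inj_on_shift_set: "inj_on (shift_set i F) F"
  by (rule inj_onI) (auto simp: shift_set_def split: if_splits)

lemma trace_image: "trace F Y = (\<lambda>A. A \<inter> Y) ` F"
  by (auto simp: trace_def)

text \<open>
  A trace of the shifted family belongs to the shifted trace, which has as many members as the
  original trace. When \<open>i\<close> lies outside \<open>Y\<close>, shifting is invisible on \<open>Y\<close>. When \<open>i\<close> lies in \<open>Y\<close>,
  a trace that still contains \<open>i\<close> comes from a set that was not moved because its partner without
  \<open>i\<close> was present, and then the partner's trace is present too.
\<close>

lemma trace_shift_subset:
  "trace (shift_set i F ` F) Y \<subseteq> shift_set i (trace F Y) ` trace F Y"
proof
  fix B assume "B \<in> trace (shift_set i F ` F) Y"
  then obtain A where A: "A \<in> F" and B: "B = shift_set i F A \<inter> Y"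
    by (auto simp: trace_image)
  have AY: "A \<inter> Y \<in> trace F Y"
    using A by (auto simp: trace_image)
  show "B \<in> shift_set i (trace F Y) ` trace F Y"
  proof (cases "i \<in> A \<inter> Y")
    case False
    then have "B = A \<inter> Y"
      using B by (auto simp: shift_set_def split: if_splits)
    with False have "B = shift_set i (trace F Y) (A \<inter> Y)"
      unfolding shift_set_def by metis
    then show ?thesis using AY by blast
  next
    case True
    show ?thesis
    proof (cases "A - {i} \<in> F")
      case 1: True
      then have BA: "B = A \<inter> Y" using B by (simp add: shift_set_def)
      have "(A - {i}) \<inter> Y \<in> trace F Y" using 1 by (auto simp: trace_image)
      moreover have "(A - {i}) \<inter> Y = A \<inter> Y - {i}" by auto
      ultimately have "B = shift_set i (trace F Y) (A \<inter> Y)"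
        using BA by (simp add: shift_set_def)
      then show ?thesis using AY by blast
    next
      case 2: False
      then have BA: "B = A \<inter> Y - {i}" using B True by (auto simp: shift_set_def)
      show ?thesis
      proof (cases "B \<in> trace F Y")
        case True
        then have "B = shift_set i (trace F Y) B" using BA by (simp add: shift_set_def)
        then show ?thesis using True by blast
      next
        case False
        then have "B = shift_set i (trace F Y) (A \<inter> Y)"
          using BA True by (simp add: shift_set_def)
        then show ?thesis using AY by blast
      qed
    qed
  qed
qed

lemma card_trace_shift_le:
  assumes "finite F"
  shows "card (trace (shift_set i F ` F) Y) \<le> card (trace F Y)"
proof -
  have fin: "finite (trace F Y)" using assms by (simp add: trace_image)
  have "card (trace (shift_set i F ` F) Y) \<le> card (shift_set i (trace F Y) ` trace F Y)"
    by (rule card_mono[OF finite_imageI[OF fin] trace_shift_subset])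
  also have "\<dots> \<le> card (trace F Y)" by (rule card_image_le[OF fin])
  finally show ?thesis .
qed

lemma hereditaryI_remove_one:
  assumes fin: "\<And>A. A \<in> K \<Longrightarrow> finite A"
    and step: "\<And>A i. A \<in> K \<Longrightarrow> i \<in> A \<Longrightarrow> A - {i} \<in> K"
  shows "hereditary K"
proof -
  have "A - D \<in> K" if "finite D" "A \<in> K" "D \<subseteq> A" for A D
    using that
  proof (induction D rule: finite_induct)
    case (insert i D)
    then have "A - D \<in> K" "i \<in> A - D" by auto
    then have "A - D - {i} \<in> K" by (rule step)
    then show ?case by (metis Diff_insert)
  qed simp
  note remove = this
  have "B \<in> K" if "A \<in> K" "B \<subseteq> A" for A B
  proof -
    have "A - (A - B) \<in> K" using remove[of "A - B" A] fin that by simp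
    then show ?thesis using that by (simp add: double_diff)
  qed
  then show ?thesis by (auto simp: hereditary_def)
qed

text \<open>
  A shift that moves some set lowers the sum of the cardinalities, so shifting ends; a family
  fixed by all shifts is hereditary.
\<close>

lemma exists_hereditary_compression:
  fixes F :: "'a set set"
  assumes "finite V" "F \<subseteq> Pow V"
  shows "\<exists>K. K \<subseteq> Pow V \<and> hereditary K \<and> card K = card F \<and>
    (\<forall>Y. card (trace K Y) \<le> card (trace F Y))"
  using assms(2)
proof (induction "\<Sum>A\<in>F. card A" arbitrary: F rule: less_induct)
  case less
  have finF: "finite F" using less.prems assms(1) by (meson finite_Pow_iff finite_subset)
  have finA: "finite A" if "A \<in> F" for A
    using that less.prems assms(1) by (meson PowD finite_subset subsetD)
  show ?case
  proof (cases "\<forall>A\<in>F. \<forall>i\<in>A. A - {i} \<in> F")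
    case True
    then have "hereditary F" by (intro hereditaryI_remove_one finA) auto
    then show ?thesis using less.prems by blast
  next
    case False
    then obtain A i where Ai: "A \<in> F" "i \<in> A" "A - {i} \<notin> F" by blast
    let ?F = "shift_set i F ` F"
    have sub: "?F \<subseteq> Pow V"
      using less.prems shift_set_subset by fastforce
    have "(\<Sum>B\<in>?F. card B) = (\<Sum>B\<in>F. card (shift_set i F B))"
      by (simp add: sum.reindex inj_on_shift_set)
    also have "\<dots> < (\<Sum>B\<in>F. card B)"
    proof (rule sum_strict_mono_ex1[OF finF])
      show "\<forall>B\<in>F. card (shift_set i F B) \<le> card B"
        using finA shift_set_subset by (metis card_mono)
      have "card (shift_set i F A) < card A"
        using Ai finA[OF Ai(1)] by (simp add: shift_set_def card_Diff1_less del: card_Diff_insert)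
      then show "\<exists>B\<in>F. card (shift_set i F B) < card B" using Ai by blast
    qed
    finally obtain K where K: "K \<subseteq> Pow V" "hereditary K" "card K = card ?F"
        "\<forall>Y. card (trace K Y) \<le> card (trace ?F Y)"
      using less.hyps[OF _ sub] by blast
    moreover have "card ?F = card F" by (rule card_image[OF inj_on_shift_set])
    ultimately show ?thesis
      using card_trace_shift_le[OF finF] by (metis order_trans)
  qed
qed

section \<open>Counting faces that meet a fixed set\<close>

abbreviation pairs :: "'a set \<Rightarrow> 'a set set" where
  "pairs W \<equiv> {G. G \<subseteq> W \<and> card G = 2}"

text \<open>
  The faces meeting \<open>S\<close> whose part outside \<open>S\<close> is \<open>G\<close>, represented by their nonempty parts
  inside \<open>S\<close>.
\<close>

definition fibre :: "'a set set \<Rightarrow> 'a set \<Rightarrow> 'a set \<Rightarrow> 'a set set" where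
  "fibre K S G = {A. A \<subseteq> S \<and> A \<noteq> {} \<and> A \<union> G \<in> K}"

lemma finite_fibre: "finite S \<Longrightarrow> finite (fibre K S G)"
  by (rule finite_subset[of _ "Pow S"]) (auto simp: fibre_def)

lemma card_meeting_eq_sum_card_fibres:
  assumes "finite V" "K \<subseteq> Pow V" "S \<subseteq> V"
  shows "card {F\<in>K. F \<inter> S \<noteq> {}} = (\<Sum>G\<in>Pow (V - S). card (fibre K S G))"
proof -
  have finS: "finite S" using assms finite_subset by blast
  have "{F\<in>K. F \<inter> S \<noteq> {}} = (\<Union>G\<in>Pow (V - S). (\<lambda>A. A \<union> G) ` fibre K S G)"
  proof (intro equalityI subsetI)
    fix F assume F: "F \<in> {F\<in>K. F \<inter> S \<noteq> {}}"
    then have "F \<inter> S \<in> fibre K S (F - S)" "F - S \<in> Pow (V - S)" "F = (F \<inter> S) \<union> (F - S)"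
      using assms(2) by (auto simp: fibre_def Int_Diff_Un)
    then show "F \<in> (\<Union>G\<in>Pow (V - S). (\<lambda>A. A \<union> G) ` fibre K S G)" by blast
  next
    fix F assume "F \<in> (\<Union>G\<in>Pow (V - S). (\<lambda>A. A \<union> G) ` fibre K S G)"
    then show "F \<in> {F\<in>K. F \<inter> S \<noteq> {}}" by (auto simp: fibre_def)
  qed
  also have "card \<dots> = (\<Sum>G\<in>Pow (V - S). card ((\<lambda>A. A \<union> G) ` fibre K S G))"
  proof (rule card_UN_disjoint)
    show "\<forall>G\<in>Pow (V - S). \<forall>G'\<in>Pow (V - S). G \<noteq> G' \<longrightarrow>
        (\<lambda>A. A \<union> G) ` fibre K S G \<inter> (\<lambda>A. A \<union> G') ` fibre K S G' = {}"
    proof (intro ballI impI)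
      fix G G' assume G: "G \<in> Pow (V - S)" "G' \<in> Pow (V - S)" "G \<noteq> G'"
      have "(A \<union> G) - S = G" if "A \<in> fibre K S G" for A
        using that G by (auto simp: fibre_def)
      moreover have "(A \<union> G') - S = G'" if "A \<in> fibre K S G'" for A
        using that G by (auto simp: fibre_def)
      ultimately show "(\<lambda>A. A \<union> G) ` fibre K S G \<inter> (\<lambda>A. A \<union> G') ` fibre K S G' = {}"
        using G(3) by fastforce
    qed
  qed (use assms finS in \<open>auto simp: finite_fibre\<close>)
  also have "\<dots> = (\<Sum>G\<in>Pow (V - S). card (fibre K S G))"
  proof (rule sum.cong[OF refl], rule card_image, rule inj_onI)
    fix G A B assume "G \<in> Pow (V - S)" "A \<in> fibre K S G" "B \<in> fibre K S G" "A \<union> G = B \<union> G"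
    then show "A = B" by (auto simp: fibre_def)
  qed
  finally show ?thesis .
qed

lemma sum_Pow_small:
  fixes f :: "'a set \<Rightarrow> nat"
  assumes fin: "finite W" and zero: "\<And>G. G \<subseteq> W \<Longrightarrow> card G > 2 \<Longrightarrow> f G = 0"
  shows "sum f (Pow W) = f {} + (\<Sum>x\<in>W. f {x}) + sum f (pairs W)"
proof -
  let ?S = "(\<lambda>x. {x}) ` W"
  have finP: "finite (pairs W)" using fin by simp
  have "sum f (Pow W) = sum f (insert {} (?S \<union> pairs W))"
  proof (rule sum.mono_neutral_right)
    show "\<forall>G\<in>Pow W - insert {} (?S \<union> pairs W). f G = 0"
    proof
      fix G assume G: "G \<in> Pow W - insert {} (?S \<union> pairs W)"
      then have fG: "finite G" using fin finite_subset by blast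
      have "card G \<noteq> 0" "card G \<noteq> 2" using G fG by auto
      moreover have "card G \<noteq> 1" using G by (auto simp: card_1_singleton_iff)
      ultimately show "f G = 0" using G by (intro zero) auto
    qed
  qed (use fin in auto)
  also have "\<dots> = f {} + (sum f ?S + sum f (pairs W))"
    using fin finP by (subst sum.insert) (auto intro!: sum.union_disjoint)
  also have "sum f ?S = (\<Sum>x\<in>W. f {x})"
    by (subst sum.reindex) auto
  finally show ?thesis by simp
qed

text \<open>
  The counting scheme behind every induction step below, for graphs as well as for complexes.
  Since members have at most three elements and the part in \<open>S\<close> is nonempty, only fibres over sets
  \<open>G\<close> with at most two elements matter.
\<close>

lemma card_le_by_removing:
  assumes fin: "finite V" and K: "K \<subseteq> Pow V" and S: "S \<subseteq> V"
    and dim: "\<And>A. A \<in> K \<Longrightarrow> card A \<le> 3"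
    and c0: "card (fibre K S {}) \<le> c0"
    and c1: "\<And>x. x \<in> V - S \<Longrightarrow> card (fibre K S {x}) \<le> c1"
    and c2: "(\<Sum>G\<in>pairs (V - S). card (fibre K S G)) \<le> q"
  shows "card K \<le> card {F\<in>K. F \<inter> S = {}} + (c0 + c1 * card (V - S) + q)"
proof -
  have finK: "finite K" using fin K by (meson finite_Pow_iff finite_subset)
  have "card K = card ({F\<in>K. F \<inter> S = {}} \<union> {F\<in>K. F \<inter> S \<noteq> {}})"
    by (rule arg_cong[of _ _ card]) auto
  also have "\<dots> = card {F\<in>K. F \<inter> S = {}} + card {F\<in>K. F \<inter> S \<noteq> {}}"
    using finK by (intro card_Un_disjoint) auto
  also have "card {F\<in>K. F \<inter> S \<noteq> {}} = (\<Sum>G\<in>Pow (V - S). card (fibre K S G))"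
    by (rule card_meeting_eq_sum_card_fibres[OF fin K S])
  also have "\<dots> = card (fibre K S {}) + (\<Sum>x\<in>V - S. card (fibre K S {x}))
      + (\<Sum>G\<in>pairs (V - S). card (fibre K S G))"
  proof (rule sum_Pow_small)
    fix G assume G: "G \<subseteq> V - S" "card G > 2"
    have "A \<notin> fibre K S G" for A
    proof
      assume A: "A \<in> fibre K S G"
      then have "finite A" "finite G" "A \<inter> G = {}" "card A > 0"
        using G fin S finite_subset[of _ V]
        by (auto simp: fibre_def card_gt_0_iff)
      then have "card (A \<union> G) > 3" using G by (simp add: card_Un_disjoint)
      then show False using dim[of "A \<union> G"] A by (simp add: fibre_def)
    qed
    then show "card (fibre K S G) = 0" by (metis card.empty equals0I)
  qed (use fin in simp)
  also have "(\<Sum>x\<in>V - S. card (fibre K S {x})) \<le> c1 * card (V - S)"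
    using sum_bounded_above[of "V - S" "\<lambda>x. card (fibre K S {x})" c1] c1
    by (simp add: mult.commute)
  finally show ?thesis using c0 c2 by linarith
qed

section \<open>Graphs without four pairwise adjacent vertices\<close>

definition clique :: "'a set set \<Rightarrow> 'a set \<Rightarrow> bool" where
  "clique E Q \<longleftrightarrow> (\<forall>u\<in>Q. \<forall>v\<in>Q. u \<noteq> v \<longrightarrow> {u, v} \<in> E)"

lemma card_pairs: "finite W \<Longrightarrow> 2 * card (pairs W) = card W * (card W - 1)"
  by (cases "card W") (auto simp: n_subsets choose_two)

lemma turan_number_remove_clique:
  fixes m q :: nat
  assumes "1 \<le> q" "q \<le> 3" "q \<le> m"
  shows "(m - q)^2 div 3 + ((q choose 2) + (q - 1) * (m - q)) \<le> m^2 div 3"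
proof -
  obtain d where d: "m = q + d" using assms(3) by (metis le_add_diff_inverse)
  have "q = 1 \<or> q = 2 \<or> q = 3" using assms by auto
  then show ?thesis
  proof (elim disjE)
    assume "q = 1" then show ?thesis using d by (simp add: div_le_mono power_mono choose_two)
  next
    assume q: "q = 2"
    have "d^2 div 3 + (1 + d) = (d^2 + 3 * (1 + d)) div 3" by simp
    also have "\<dots> \<le> (2 + d)^2 div 3"
      by (rule div_le_mono) (simp add: power2_eq_square algebra_simps)
    finally show ?thesis using q d by (simp add: choose_two)
  next
    assume q: "q = 3"
    have "d^2 div 3 + (3 + 2 * d) = (d^2 + 3 * (3 + 2 * d)) div 3" by simp
    also have "\<dots> \<le> (3 + d)^2 div 3"
      by (rule div_le_mono) (simp add: power2_eq_square algebra_simps)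
    finally show ?thesis using q d by (simp add: choose_two)
  qed
qed

text \<open>
  Turan's theorem for four pairwise adjacent vertices. A largest clique \<open>Q\<close> is removed; it has at
  most three vertices, and every other vertex misses at least one of them.
\<close>

lemma turan_K4:
  assumes "finite V" "E \<subseteq> pairs V"
    and "\<And>Q. Q \<subseteq> V \<Longrightarrow> clique E Q \<Longrightarrow> card Q < 4"
  shows "card E \<le> (card V)^2 div 3"
  using assms
proof (induction "card V" arbitrary: V E rule: less_induct)
  case less
  note fin = less.prems(1) and E = less.prems(2) and noK4 = less.prems(3)
  show ?case
  proof (cases "V = {}")
    case True
    then have "E = {}" using E by auto
    then show ?thesis by simp
  next
    case False
    then obtain v where v: "v \<in> V" by blast
    let ?P = "\<lambda>Q. Q \<subseteq> V \<and> clique E Q"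
    have "?P {v}" using v by (simp add: clique_def)
    moreover have "\<forall>Q. ?P Q \<longrightarrow> card Q < 4" using noK4 by blast
    ultimately obtain Q where Q: "Q \<subseteq> V" "clique E Q"
        and max: "\<And>R. R \<subseteq> V \<Longrightarrow> clique E R \<Longrightarrow> card R \<le> card Q"
      using ex_has_greatest_nat[where P = ?P and f = card and b = 4 and k = "{v}"] by metis
    have finQ: "finite Q" using Q fin finite_subset by blast
    have q1: "1 \<le> card Q" using max[of "{v}"] v by (simp add: clique_def)
    have q3: "card Q \<le> 3" using noK4[OF Q] by simp
    have qV: "card Q \<le> card V" using Q fin by (simp add: card_mono)
    have "card E \<le> card {F\<in>E. F \<inter> Q = {}} + ((card Q choose 2) + (card Q - 1) * card (V - Q) + 0)"
    proof (rule card_le_by_removing[OF fin _ Q(1)])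
      show "E \<subseteq> Pow V" using E by auto
      show "card A \<le> 3" if "A \<in> E" for A using that E by auto
      have "card (fibre E Q {}) \<le> card (pairs Q)"
        using finQ E by (intro card_mono) (auto simp: fibre_def)
      then show "card (fibre E Q {}) \<le> card Q choose 2" using finQ by (simp add: n_subsets)
    next
      fix x assume x: "x \<in> V - Q"
      have "\<not> clique E (insert x Q)"
        using max[of "insert x Q"] x Q finQ by auto
      then obtain u where u: "u \<in> Q" "{u, x} \<notin> E"
        using Q(2) by (auto simp: clique_def insert_commute)
      have "fibre E Q {x} \<subseteq> (\<lambda>w. {w}) ` (Q - {u})"
      proof
        fix A assume A: "A \<in> fibre E Q {x}"
        then have "card (insert x A) = 2" "x \<notin> A" "finite A"
          using E x finQ finite_subset[of A Q] by (auto simp: fibre_def)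
        then have "card A = 1" by simp
        then obtain w where "A = {w}" by (auto simp: card_1_singleton_iff)
        then show "A \<in> (\<lambda>w. {w}) ` (Q - {u})"
          using A u by (auto simp: fibre_def insert_commute)
      qed
      then have "card (fibre E Q {x}) \<le> card (Q - {u})"
        using finQ by (meson card_image_le card_mono finite_Diff finite_imageI order_trans)
      then show "card (fibre E Q {x}) \<le> card Q - 1" using u finQ by simp
    next
      have "fibre E Q G = {}" if "G \<in> pairs (V - Q)" for G
      proof (rule equals0I)
        fix A assume A: "A \<in> fibre E Q G"
        then have "finite A" "finite G" "A \<inter> G = {}" "card A > 0" "card (A \<union> G) = 2"
          using that fin E finQ finite_subset[of A Q] finite_subset[of G V]
          by (auto simp: fibre_def card_gt_0_iff)
        then show False using that by (simp add: card_Un_disjoint)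
      qed
      then show "(\<Sum>G\<in>pairs (V - Q). card (fibre E Q G)) \<le> 0" by simp
    qed
    also have "card {F\<in>E. F \<inter> Q = {}} \<le> (card (V - Q))^2 div 3"
    proof (rule less.hyps)
      show "card (V - Q) < card V"
        using Q q1 fin finQ qV by (simp add: card_Diff_subset)
      show "{F\<in>E. F \<inter> Q = {}} \<subseteq> pairs (V - Q)" using E by auto
      show "card R < 4" if "R \<subseteq> V - Q" "clique {F\<in>E. F \<inter> Q = {}} R" for R
        using that by (intro noK4) (auto simp: clique_def)
    qed (use fin in simp)
    also have "card (V - Q) = card V - card Q"
      using Q finQ by (simp add: card_Diff_subset)
    finally show ?thesis using turan_number_remove_clique[OF q1 q3 qV] by simp
  qed
qed

section \<open>Arithmetic of the extremal number\<close>

definition box :: "nat \<Rightarrow> nat" where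
  "box n = (\<Prod>i\<in>{0..<3}. (n + 3 + i) div 3)"

lemma box_mod3:
  "box (3 * k) = (k + 1) * (k + 1) * (k + 1)"
  "box (3 * k + 1) = (k + 1) * (k + 1) * (k + 2)"
  "box (3 * k + 2) = (k + 1) * (k + 2) * (k + 2)"
proof -
  have *: "box n = ((n + 3) div 3) * ((n + 4) div 3) * ((n + 5) div 3)" for n
  proof -
    have "{0..<3} = {0, 1, 2 :: nat}" by auto
    then show ?thesis by (simp add: box_def ac_simps)
  qed
  have r: "(3 * k + 3) div 3 = k + 1" "(3 * k + 4) div 3 = k + 1" "(3 * k + 5) div 3 = k + 1"
    "(3 * k + 1 + 3) div 3 = k + 1" "(3 * k + 1 + 4) div 3 = k + 1" "(3 * k + 1 + 5) div 3 = k + 2"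
    "(3 * k + 2 + 3) div 3 = k + 1" "(3 * k + 2 + 4) div 3 = k + 2" "(3 * k + 2 + 5) div 3 = k + 2"
    by presburger+
  show "box (3 * k) = (k + 1) * (k + 1) * (k + 1)"
    "box (3 * k + 1) = (k + 1) * (k + 1) * (k + 2)"
    "box (3 * k + 2) = (k + 1) * (k + 2) * (k + 2)"
    unfolding * r by (rule refl)+
qed

lemma mod3_cases:
  fixes n :: nat
  obtains k where "n = 3 * k" | k where "n = 3 * k + 1" | k where "n = 3 * k + 2"
proof -
  have "n = 3 * (n div 3) \<or> n = 3 * (n div 3) + 1 \<or> n = 3 * (n div 3) + 2" by presburger
  then show ?thesis using that by blast
qed

lemma box_add1: "box m + (m + 1) \<le> box (m + 1)"
proof (cases m rule: mod3_cases)
  case (1 k) then show ?thesis using box_mod3[of k] by (simp add: algebra_simps)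
next
  case (2 k) then show ?thesis using box_mod3[of k] by (simp add: algebra_simps)
next
  case (3 k)
  then have e: "m + 1 = 3 * (k + 1)" by simp
  show ?thesis unfolding e using 3 box_mod3[of k] box_mod3(1)[of "k + 1"]
    by (simp add: algebra_simps)
qed

text \<open>
  Removing one vertex from each class of the extremal partition destroys exactly this many
  faces: those meeting a transversal triple in the balanced complex.
\<close>

lemma box_add3: "box m + (7 + 3 * m + m^2 div 3) = box (m + 3)"
proof (cases m rule: mod3_cases)
  case (1 k)
  then have e: "m + 3 = 3 * (k + 1)" by simp
  have "m^2 = 3 * (3 * k * k)" using 1 by (simp add: power2_eq_square)
  then have "m^2 div 3 = 3 * k * k" by simp
  then show ?thesis unfolding e using 1 box_mod3(1)[of k] box_mod3(1)[of "k + 1"]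
    by (simp add: algebra_simps)
next
  case (2 k)
  then have e: "m + 3 = 3 * (k + 1) + 1" by simp
  have "m^2 = 1 + 3 * (3 * k * k + 2 * k)" using 2 by (simp add: power2_eq_square algebra_simps)
  then have "m^2 div 3 = 3 * k * k + 2 * k" by simp
  then show ?thesis unfolding e using 2 box_mod3(2)[of k] box_mod3(2)[of "k + 1"]
    by (simp add: algebra_simps)
next
  case (3 k)
  then have e: "m + 3 = 3 * (k + 1) + 2" by simp
  have "m^2 = 1 + 3 * (3 * k * k + 4 * k + 1)" using 3 by (simp add: power2_eq_square algebra_simps)
  then have "m^2 div 3 = 3 * k * k + 4 * k + 1" by simp
  then show ?thesis unfolding e using 3 box_mod3(3)[of k] box_mod3(3)[of "k + 1"]
    by (simp add: algebra_simps)
qed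

text \<open>
  The bound needed for removing seven pairwise adjacent vertices, doubled so that the binomial
  coefficient \<open>m choose 2 = m * (m - 1) / 2\<close>, estimated by \<open>m * m / 2\<close>, leaves no fractions.
\<close>

lemma box_add7: "2 * box m + 70 + 20 * m + m * m \<le> 2 * box (m + 7)"
proof (cases m rule: mod3_cases)
  case (1 k)
  then have e: "m + 7 = 3 * (k + 2) + 1" by simp
  show ?thesis unfolding e using 1 box_mod3(1)[of k] box_mod3(2)[of "k + 2"]
    by (simp add: algebra_simps)
next
  case (2 k)
  then have e: "m + 7 = 3 * (k + 2) + 2" by simp
  show ?thesis unfolding e using 2 box_mod3(2)[of k] box_mod3(3)[of "k + 2"]
    by (simp add: algebra_simps)
next
  case (3 k)
  then have e: "m + 7 = 3 * (k + 3)" by simp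
  show ?thesis unfolding e using 3 box_mod3(3)[of k] box_mod3(1)[of "k + 3"]
    by (simp add: algebra_simps)
qed

section \<open>Cancellative complexes\<close>

text \<open>
  For two triples with two common elements, \<open>{u, v}\<close> is their symmetric difference. Triples with
  fewer common elements have a symmetric difference of more than three elements, so the last clause
  says that no face contains the symmetric difference of two distinct triples.
\<close>

definition cancellative :: "'a set set \<Rightarrow> bool" where
  "cancellative K \<longleftrightarrow> hereditary K \<and> (\<forall>A\<in>K. card A \<le> 3) \<and>
    (\<forall>G u v. card G = 2 \<and> u \<notin> G \<and> v \<notin> G \<and> u \<noteq> v \<and> insert u G \<in> K \<and> insert v G \<in> K
       \<longrightarrow> {u, v} \<notin> K)"

lemma cancellative_subset:
  "cancellative K \<Longrightarrow> A \<in> K \<Longrightarrow> B \<subseteq> A \<Longrightarrow> B \<in> K"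
  by (auto simp: cancellative_def hereditary_def)

lemma cancellative_card: "cancellative K \<Longrightarrow> A \<in> K \<Longrightarrow> card A \<le> 3"
  by (auto simp: cancellative_def)

lemma cancellativeD:
  "cancellative K \<Longrightarrow> card G = 2 \<Longrightarrow> u \<notin> G \<Longrightarrow> v \<notin> G \<Longrightarrow> u \<noteq> v \<Longrightarrow>
    insert u G \<in> K \<Longrightarrow> insert v G \<in> K \<Longrightarrow> {u, v} \<notin> K"
  by (auto simp: cancellative_def)

lemma cancellative_avoiding:
  assumes K: "cancellative K"
  shows "cancellative {F\<in>K. F \<inter> S = {}}"
  unfolding cancellative_def
proof (intro conjI ballI allI impI)
  show "hereditary {F\<in>K. F \<inter> S = {}}"
    using K by (auto simp: cancellative_def hereditary_def)
  show "card A \<le> 3" if "A \<in> {F\<in>K. F \<inter> S = {}}" for A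
    using that cancellative_card[OF K] by simp
  show "{u, v} \<notin> {F\<in>K. F \<inter> S = {}}"
    if "card G = 2 \<and> u \<notin> G \<and> v \<notin> G \<and> u \<noteq> v \<and> insert u G \<in> {F\<in>K. F \<inter> S = {}} \<and>
      insert v G \<in> {F\<in>K. F \<inter> S = {}}" for G u v
    using that cancellativeD[OF K, of G u v] by simp
qed

text \<open>
  If two vertices of \<open>S\<close> both complete \<open>G\<close> to a triple, they cannot be adjacent.
\<close>

lemma fibre_of_pair_over_clique:
  assumes K: "cancellative K" and S: "clique K S" "finite S"
    and G: "card G = 2" "G \<inter> S = {}"
  shows "fibre K S G \<subseteq> (\<lambda>u. {u}) ` S" and "card (fibre K S G) \<le> 1"
proof -
  have finG: "finite G" using G by (metis card.infinite zero_neq_numeral)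
  show sub: "fibre K S G \<subseteq> (\<lambda>u. {u}) ` S"
  proof
    fix A assume A: "A \<in> fibre K S G"
    then have "finite A" "A \<inter> G = {}" "card A > 0" "card (A \<union> G) \<le> 3"
      using S G cancellative_card[OF K] finite_subset[of A S]
      by (auto simp: fibre_def card_gt_0_iff)
    then have "card A = 1" using G finG by (simp add: card_Un_disjoint)
    then show "A \<in> (\<lambda>u. {u}) ` S" using A by (auto simp: fibre_def card_1_singleton_iff)
  qed
  have "A = B" if AB: "A \<in> fibre K S G" "B \<in> fibre K S G" for A B
  proof -
    obtain u v where uv: "A = {u}" "B = {v}" "u \<in> S" "v \<in> S" 
      using subsetD[OF sub AB(1)] subsetD[OF sub AB(2)] by auto
    then have "insert u G \<in> K" "insert v G \<in> K" "u \<notin> G" "v \<notin> G"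
      using AB G by (auto simp: fibre_def)
    then have "u = v" using cancellativeD[OF K G(1)] S(1) uv unfolding clique_def by blast
    then show ?thesis using uv by simp
  qed
  then have "\<forall>A\<in>fibre K S G. \<forall>B\<in>fibre K S G. A = B" by blast
  then show "card (fibre K S G) \<le> 1"
    using finite_fibre[OF S(2)] by (simp add: card_le_Suc0_iff_eq)
qed

lemma sum_eq_card_support:
  fixes f :: "'a \<Rightarrow> nat"
  assumes "finite I" "\<And>i. i \<in> I \<Longrightarrow> f i \<le> 1"
  shows "sum f I = card {i\<in>I. f i \<noteq> 0}"
proof -
  have "sum f I = (\<Sum>i\<in>I. if f i \<noteq> 0 then 1 else 0)"
  proof (rule sum.cong[OF refl])
    fix i assume "i \<in> I"
    then have "f i \<le> 1" by (rule assms(2))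
    then show "f i = (if f i \<noteq> 0 then 1 else 0)" by auto
  qed
  also have "\<dots> = card {i\<in>I. f i \<noteq> 0}"
    using assms(1) by (simp add: sum.If_cases Int_def)
  finally show ?thesis .
qed

lemma card_mult_le_of_disjoint:
  assumes "finite U" "\<And>A. A \<in> T \<Longrightarrow> f A \<subseteq> U" "\<And>A. A \<in> T \<Longrightarrow> card (f A) = k"
    and "\<And>A B. A \<in> T \<Longrightarrow> B \<in> T \<Longrightarrow> A \<noteq> B \<Longrightarrow> f A \<inter> f B = {}" and "finite T"
  shows "k * card T \<le> card U"
proof -
  have "card (\<Union>A\<in>T. f A) = (\<Sum>A\<in>T. card (f A))"
    using assms finite_subset[of _ U] by (intro card_UN_disjoint) auto
  also have "\<dots> = k * card T" using assms(3) by (simp add: mult.commute)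
  finally show ?thesis
    using card_mono[OF assms(1), of "\<Union>A\<in>T. f A"] assms(2) by auto
qed

section \<open>Removing seven pairwise adjacent vertices\<close>

text \<open>
  \<open>35 = 7 + 21 + 7\<close>: all vertices, all edges, and at most seven triples. Two triples with a common
  pair would make an edge inside \<open>S\<close> forbidden, so the triples have disjoint sets of three pairs
  among the 21 pairs of \<open>S\<close>. The Fano plane attains this, and with the empty face gives
  \<open>36 = box 7\<close>, so there is no slack here.
\<close>

lemma card_faces_in_K7_le:
  assumes K: "cancellative K" and S: "clique K S" "card S = 7"
  shows "card (fibre K S {}) \<le> 35"
proof -
  have finS: "finite S" using S by (metis card.infinite zero_neq_numeral)
  let ?T = "{A\<in>K. A \<subseteq> S \<and> card A = 3}"
  have finT: "finite ?T" using finS by (auto intro: finite_subset[of _ "Pow S"])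
  have "3 * card ?T \<le> card (pairs S)"
  proof (rule card_mult_le_of_disjoint[where f = pairs])
    show "finite (pairs S)" using finS by simp
    fix A assume A: "A \<in> ?T"
    then show "pairs A \<subseteq> pairs S" by auto
    have "finite A" using A finS finite_subset by blast
    then show "card (pairs A) = 3" using A by (simp add: n_subsets choose_two)
    fix B assume B: "B \<in> ?T" "A \<noteq> B"
    have ext: "\<exists>u. u \<notin> G \<and> C = insert u G" if "G \<in> pairs C" "C \<in> ?T" for C G
    proof -
      have "finite C" using that finS by (auto intro: finite_subset)
      moreover from this have "finite G" using that by (auto intro: finite_subset)
      ultimately have "card (C - G) = 1" using that by (simp add: card_Diff_subset)
      then obtain u where "C - G = {u}" by (auto simp: card_1_singleton_iff)
      then show ?thesis using that by (intro exI[of _ u]) auto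
    qed
    show "pairs A \<inter> pairs B = {}"
    proof (rule equals0I)
      fix G assume G: "G \<in> pairs A \<inter> pairs B"
      obtain u v where uv: "u \<notin> G" "A = insert u G" "v \<notin> G" "B = insert v G"
        using ext[of G A] ext[of G B] A B G by blast
      then have "u \<noteq> v" using B by auto
      then have "{u, v} \<notin> K" using cancellativeD[OF K, of G u v] uv A B G by auto
      moreover have "u \<in> S" "v \<in> S" using A B uv by auto
      ultimately show False using S(1) \<open>u \<noteq> v\<close> by (auto simp: clique_def)
    qed
  qed (rule finT)
  then have T: "card ?T \<le> 7" using finS S by (simp add: n_subsets choose_two)
  have "fibre K S {} \<subseteq> (\<lambda>u. {u}) ` S \<union> pairs S \<union> ?T"
  proof
    fix A assume A: "A \<in> fibre K S {}"
    then have "finite A" using finS finite_subset by (auto simp: fibre_def)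
    then have "card A = 1 \<or> card A = 2 \<or> card A = 3"
      using A cancellative_card[OF K, of A] card_gt_0_iff[of A] by (auto simp: fibre_def)
    then show "A \<in> (\<lambda>u. {u}) ` S \<union> pairs S \<union> ?T"
      using A by (auto simp: fibre_def card_1_singleton_iff)
  qed
  then have "card (fibre K S {}) \<le> card ((\<lambda>u. {u}) ` S \<union> pairs S \<union> ?T)"
    using finS finT by (intro card_mono) auto
  also have "\<dots> \<le> card ((\<lambda>u. {u}) ` S) + card (pairs S) + card ?T"
    by (meson add_le_mono card_Un_le order_refl order_trans)
  also have "card ((\<lambda>u. {u}) ` S) \<le> 7" using card_image_le[OF finS] S by metis
  also have "card (pairs S) = 21" using finS S by (simp add: n_subsets choose_two)
  finally show ?thesis using T by simp
qed

text \<open>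
  \<open>10 = 7 + 3\<close>: the pairs of \<open>S\<close> that form a triple with \<open>x\<close> are disjoint, because \<open>{x, y, u}\<close> and
  \<open>{x, y, v}\<close> would forbid the edge \<open>{u, v}\<close>. Seven vertices contain at most three disjoint pairs.
\<close>

lemma card_faces_K7_plus_vertex_le:
  assumes K: "cancellative K" and S: "clique K S" "card S = 7" and x: "x \<notin> S"
  shows "card (fibre K S {x}) \<le> 10"
proof -
  have finS: "finite S" using S by (metis card.infinite zero_neq_numeral)
  \<comment> \<open>The pairs inside \<open>S\<close> that form a triple with \<open>x\<close>.\<close>
  let ?M = "{A. A \<subseteq> S \<and> card A = 2 \<and> insert x A \<in> K}"
  have finM: "finite ?M" using finS by (auto intro: finite_subset[of _ "Pow S"])
  have "2 * card ?M \<le> card S"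
  proof (rule card_mult_le_of_disjoint[where f = "\<lambda>A. A"])
    fix A B assume A: "A \<in> ?M" and B: "B \<in> ?M" and ne: "A \<noteq> B"
    show "A \<inter> B = {}"
    proof (rule equals0I)
      fix y assume y: "y \<in> A \<inter> B"
      have ext: "\<exists>u. u \<noteq> y \<and> C = {y, u}" if "y \<in> C" "C \<in> ?M" for C
        using that by (fastforce simp: card_2_iff)
      obtain u v where uv: "u \<noteq> y" "A = {y, u}" "v \<noteq> y" "B = {y, v}"
        using ext[of A] ext[of B] A B y by blast
      have "x \<noteq> y" "u \<noteq> x" "v \<noteq> x" "u \<noteq> v" using x A B uv ne by auto
      moreover have "insert u {x, y} \<in> K" "insert v {x, y} \<in> K"
        using A B uv by (auto simp: insert_commute)
      ultimately have "{u, v} \<notin> K"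
        using uv by (intro cancellativeD[OF K, of "{x, y}"]) auto
      moreover have "u \<in> S" "v \<in> S" using A B uv by auto
      ultimately show False using S(1) \<open>u \<noteq> v\<close> by (auto simp: clique_def)
    qed
  qed (use finS finM in auto)
  then have M: "card ?M \<le> 3" using S by simp
  have "fibre K S {x} \<subseteq> (\<lambda>u. {u}) ` S \<union> ?M"
  proof
    fix A assume A: "A \<in> fibre K S {x}"
    then have "finite A" "x \<notin> A" using finS x finite_subset by (auto simp: fibre_def)
    then have "card A = 1 \<or> card A = 2"
      using A cancellative_card[OF K, of "insert x A"] card_gt_0_iff[of A]
      by (auto simp: fibre_def)
    then show "A \<in> (\<lambda>u. {u}) ` S \<union> ?M"
      using A by (auto simp: fibre_def card_1_singleton_iff)
  qed
  then have "card (fibre K S {x}) \<le> card ((\<lambda>u. {u}) ` S \<union> ?M)"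
    using finS finM by (intro card_mono) auto
  also have "\<dots> \<le> card ((\<lambda>u. {u}) ` S) + card ?M" by (rule card_Un_le)
  also have "card ((\<lambda>u. {u}) ` S) \<le> 7" using card_image_le[OF finS] S by metis
  finally show ?thesis using M by simp
qed

section \<open>Removing a triple\<close>

text \<open>
  If \<open>x\<close> forms a triple with two vertices of \<open>S\<close>, then that triple and \<open>S\<close> share a pair, so \<open>x\<close> is
  not adjacent to the third vertex of \<open>S\<close>. Hence such a triple costs an edge, and it is the only one.
  Otherwise \<open>x\<close> contributes only edges.
\<close>

lemma card_faces_triple_plus_vertex_le:
  assumes K: "cancellative K" and S: "S \<in> K" "card S = 3" and x: "x \<notin> S"
  shows "card (fibre K S {x}) \<le> 3"
proof -
  have finS: "finite S" using S by (metis card.infinite zero_neq_numeral)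
  show ?thesis
  proof (cases "\<exists>A\<subseteq>S. card A = 2 \<and> insert x A \<in> K")
    case True
    then obtain A where A: "A \<subseteq> S" "card A = 2" "insert x A \<in> K" by blast
    have finA: "finite A" using A finS finite_subset by blast
    have "card (S - A) = 1" using A S finA by (simp add: card_Diff_subset)
    then obtain w where w: "S - A = {w}" by (auto simp: card_1_singleton_iff)
    then have "S = insert w A" "w \<notin> A" using A by auto
    then have wx: "{w, x} \<notin> K"
      using cancellativeD[OF K A(2), of w x] A S x by auto
    have "fibre K S {x} \<subseteq> Pow A - {{}}"
    proof
      fix B assume B: "B \<in> fibre K S {x}"
      then have "w \<notin> B"
        using wx cancellative_subset[OF K, of "B \<union> {x}" "{w, x}"] by (auto simp: fibre_def)
      then show "B \<in> Pow A - {{}}" using B \<open>S = insert w A\<close> by (auto simp: fibre_def)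
    qed
    then have "card (fibre K S {x}) \<le> card (Pow A - {{}})"
      using finA by (intro card_mono) auto
    also have "\<dots> = 3" using finA A by (simp add: card_Pow)
    finally show ?thesis .
  next
    case False
    have "fibre K S {x} \<subseteq> (\<lambda>u. {u}) ` S"
    proof
      fix A assume A: "A \<in> fibre K S {x}"
      then have "finite A" "x \<notin> A" using finS x finite_subset by (auto simp: fibre_def)
      then have "card A = 1 \<or> card A = 2"
        using A cancellative_card[OF K, of "insert x A"] card_gt_0_iff[of A]
        by (auto simp: fibre_def)
      then show "A \<in> (\<lambda>u. {u}) ` S"
        using A False by (auto simp: fibre_def card_1_singleton_iff)
    qed
    then have "card (fibre K S {x}) \<le> card S"
      using finS by (meson card_image_le card_mono finite_imageI order_trans)
    then show ?thesis using S by simp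
  qed
qed

text \<open>
  Colour a pair of \<open>Q\<close> by a vertex of \<open>S\<close> that completes it to a triple. Two pairs \<open>{x, y}\<close>, \<open>{x, z}\<close>
  of the same colour \<open>u\<close> would forbid the edge \<open>{y, z}\<close>. So the three pairs at \<open>x\<close> use all three colours,
  which makes \<open>x\<close> adjacent to all of \<open>S\<close>.
\<close>

lemma K4_in_link_gives_K7:
  assumes K: "cancellative K" and S: "S \<in> K" "card S = 3"
    and Q: "Q \<inter> S = {}" "card Q = 4"
    and link: "\<And>x y. x \<in> Q \<Longrightarrow> y \<in> Q \<Longrightarrow> x \<noteq> y \<Longrightarrow> \<exists>u\<in>S. {u, x, y} \<in> K"
  shows "clique K (S \<union> Q)"
proof -
  have finS: "finite S" using S by (metis card.infinite zero_neq_numeral)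
  have finQ: "finite Q" using Q by (metis card.infinite zero_neq_numeral)
  have QQ: "{x, y} \<in> K" if "x \<in> Q" "y \<in> Q" "x \<noteq> y" for x y
    using link[OF that] cancellative_subset[OF K] by blast
  have SQ: "{u, x} \<in> K" if "u \<in> S" "x \<in> Q" for u x
  proof -
    \<comment> \<open>The colour of the pair \<open>{x, y}\<close>, for the fixed vertex \<open>x\<close>.\<close>
    define col where "col y = (SOME u. u \<in> S \<and> {u, x, y} \<in> K)" for y
    have col: "col y \<in> S \<and> {col y, x, y} \<in> K" if "y \<in> Q - {x}" for y
    proof -
      have "\<exists>u. u \<in> S \<and> {u, x, y} \<in> K" using link[of x y] that \<open>x \<in> Q\<close> by blast
      then show ?thesis unfolding col_def by (rule someI_ex)
    qed
    have "inj_on col (Q - {x})"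
    proof (rule inj_onI, rule ccontr)
      fix y z assume yz: "y \<in> Q - {x}" "z \<in> Q - {x}" "col y = col z" "y \<noteq> z"
      let ?G = "{col y, x}"
      have "col y \<in> S" using col[OF yz(1)] by blast
      then have "col y \<noteq> x" "y \<notin> ?G" "z \<notin> ?G" using yz Q(1) \<open>x \<in> Q\<close> by auto
      moreover have "insert y ?G \<in> K" "insert z ?G \<in> K"
        using col[OF yz(1)] col[OF yz(2)] yz(3) by (auto simp: insert_commute)
      ultimately have "{y, z} \<notin> K" using yz(4)
        by (intro cancellativeD[OF K, of ?G]) auto
      then show False using QQ yz by blast
    qed
    then have "card (col ` (Q - {x})) = card S"
      using Q S \<open>x \<in> Q\<close> finQ by (simp add: card_image)
    moreover have "col ` (Q - {x}) \<subseteq> S" using col by blast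
    ultimately have "col ` (Q - {x}) = S" using finS by (meson card_subset_eq)
    then obtain y where "y \<in> Q - {x}" "u = col y" using \<open>u \<in> S\<close> by blast
    then have "{u, x, y} \<in> K" using col by blast
    then show ?thesis by (rule cancellative_subset[OF K]) auto
  qed
  have SS: "{u, v} \<in> K" if "u \<in> S" "v \<in> S" for u v
    by (rule cancellative_subset[OF K S(1)]) (use that in auto)
  have QS: "{x, u} \<in> K" if "u \<in> S" "x \<in> Q" for u x
    using SQ[OF that] by (simp add: insert_commute)
  show ?thesis
    unfolding clique_def by (auto intro: QQ SQ SS QS)
qed

section \<open>Cancellative complexes have at most box n faces\<close>

text \<open>
  Cliques of seven vertices are removed first, so that the graph used when a triple is removed has
  no four pairwise adjacent vertices.
\<close>

lemma cancellative_card_le_box: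
  assumes "finite V" "K \<subseteq> Pow V" "cancellative K"
  shows "card K \<le> box (card V)"
  using assms
proof (induction "card V" arbitrary: V K rule: less_induct)
  case less
  note fin = less.prems(1) and KV = less.prems(2) and K = less.prems(3)
  note dim = cancellative_card[OF K]
  have finP: "finite (pairs W)" if "W \<subseteq> V" for W
    using finite_subset[OF that fin] by simp
  have rest: "card {F\<in>K. F \<inter> S = {}} \<le> box (card (V - S))" if "S \<subseteq> V" "S \<noteq> {}" for S
  proof (rule less.hyps)
    show "card (V - S) < card V" using that fin by (intro psubset_card_mono) auto
    show "{F\<in>K. F \<inter> S = {}} \<subseteq> Pow (V - S)" using KV by auto
    show "cancellative {F\<in>K. F \<inter> S = {}}" by (rule cancellative_avoiding[OF K])
  qed (use fin in simp)
  consider (K7) S where "S \<subseteq> V" "clique K S" "card S = 7"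
    | (triple) S where "S \<in> K" "card S = 3" "\<nexists>S. S \<subseteq> V \<and> clique K S \<and> card S = 7"
    | (graph) v where "v \<in> V" "\<And>A. A \<in> K \<Longrightarrow> card A \<noteq> 3"
    | (empty) "V = {}"
  proof (cases "\<exists>S. S \<subseteq> V \<and> clique K S \<and> card S = 7")
    case True then show ?thesis using that(1) by blast
  next
    case noK7: False
    show ?thesis
    proof (cases "\<exists>S\<in>K. card S = 3")
      case True then show ?thesis using that(2) noK7 by blast
    next
      case no3: False
      show ?thesis
      proof (cases "V = {}")
        case True then show ?thesis by (rule that(4))
      next
        case False
        then obtain v where "v \<in> V" by blast
        then show ?thesis using that(3) no3 by metis
      qed
    qed
  qed
  then show ?case
  proof cases
    case K7
    have finS: "finite S" using K7 fin finite_subset by blast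
    let ?m = "card (V - S)"
    have sum: "(\<Sum>G\<in>pairs (V - S). card (fibre K S G)) \<le> card (pairs (V - S))"
    proof -
      have "card (fibre K S G) \<le> 1" if "G \<in> pairs (V - S)" for G
        using that K7 finS by (intro fibre_of_pair_over_clique[OF K]) auto
      then show ?thesis
        using sum_bounded_above[of "pairs (V - S)" "\<lambda>G. card (fibre K S G)" 1] by simp
    qed
    have "card K \<le> card {F\<in>K. F \<inter> S = {}} + (35 + 10 * ?m + card (pairs (V - S)))"
      using K7 K by (intro card_le_by_removing[OF fin KV _ dim] sum card_faces_in_K7_le card_faces_K7_plus_vertex_le) auto
    moreover have "card {F\<in>K. F \<inter> S = {}} \<le> box ?m" using K7 by (intro rest) auto
    moreover have "2 * card (pairs (V - S)) \<le> ?m * ?m"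
      using card_pairs[of "V - S"] fin by simp
    moreover have "2 * box ?m + 70 + 20 * ?m + ?m * ?m \<le> 2 * box (?m + 7)" by (rule box_add7)
    moreover have "?m + 7 = card V"
      using K7 finS card_mono[OF fin K7(1)] by (simp add: card_Diff_subset)
    ultimately show ?thesis by simp
  next
    case triple
    have SV: "S \<subseteq> V" using triple KV by auto
    have finS: "finite S" using SV fin finite_subset by blast
    have clS: "clique K S"
      using cancellative_subset[OF K triple(1)] by (auto simp: clique_def)
    let ?m = "card (V - S)"
    \<comment> \<open>The coloured pairs: those that some vertex of \<open>S\<close> completes to a triple.\<close>
    let ?L = "{G\<in>pairs (V - S). card (fibre K S G) \<noteq> 0}"
    have L: "\<exists>u\<in>S. insert u G \<in> K" if "G \<in> ?L" for G
    proof -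
      have "fibre K S G \<noteq> {}" using that by auto
      moreover have "fibre K S G \<subseteq> (\<lambda>u. {u}) ` S"
        using that finS clS by (intro fibre_of_pair_over_clique(1)[OF K]) auto
      ultimately show ?thesis by (auto simp: fibre_def)
    qed
    have "(\<Sum>G\<in>pairs (V - S). card (fibre K S G)) = card ?L"
    proof (rule sum_eq_card_support[OF finP])
      fix G assume "G \<in> pairs (V - S)"
      then show "card (fibre K S G) \<le> 1"
        using finS clS by (intro fibre_of_pair_over_clique(2)[OF K]) auto
    qed simp
    also have "\<dots> \<le> ?m^2 div 3"
    proof (rule turan_K4)
      show "card Q < 4" if Q: "Q \<subseteq> V - S" "clique ?L Q" for Q
      proof (rule ccontr)
        assume "\<not> card Q < 4"
        then obtain R where R: "R \<subseteq> Q" "card R = 4"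
          using obtain_subset_with_card_n[of 4 Q] by (metis linorder_not_less)
        have "clique K (S \<union> R)"
        proof (rule K4_in_link_gives_K7[OF K triple(1,2) _ R(2)])
          show "R \<inter> S = {}" using R Q by auto
          fix x y assume "x \<in> R" "y \<in> R" "x \<noteq> y"
          then have "{x, y} \<in> ?L" using Q R unfolding clique_def by blast
          from L[OF this] show "\<exists>u\<in>S. {u, x, y} \<in> K" .
        qed
        moreover have "card (S \<union> R) = 7"
        proof -
          have "finite R" using R by (metis card.infinite zero_neq_numeral)
          moreover have "S \<inter> R = {}" using R Q by auto
          ultimately show ?thesis using triple(2) R finS by (simp add: card_Un_disjoint)
        qed
        moreover have "S \<union> R \<subseteq> V" using SV R Q by auto
        ultimately show False using triple(3) by blast
      qed
    qed (use fin in auto)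
    finally have sum: "(\<Sum>G\<in>pairs (V - S). card (fibre K S G)) \<le> ?m^2 div 3" .
    have "card (fibre K S {}) \<le> card (Pow S - {{}})"
      using finS by (intro card_mono) (auto simp: fibre_def)
    also have "\<dots> = 7" using finS triple by (simp add: card_Pow)
    finally have "card K \<le> card {F\<in>K. F \<inter> S = {}} + (7 + 3 * ?m + ?m^2 div 3)"
      using triple by (intro card_le_by_removing[OF fin KV SV dim _ _ sum]
          card_faces_triple_plus_vertex_le[OF K]) auto
    also have "\<dots> \<le> box ?m + (7 + 3 * ?m + ?m^2 div 3)"
      using rest[OF SV] triple(2) by (cases "S = {}") auto
    also have "\<dots> = box (?m + 3)" by (rule box_add3)
    also have "?m + 3 = card V"
      using triple finS card_mono[OF fin SV] SV by (simp add: card_Diff_subset)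
    finally show ?thesis .
  next
    case graph
    have dim2: "card A \<le> 2" if "A \<in> K" for A using dim[OF that] graph(2)[OF that] by simp
    let ?S = "{v}" and ?m = "card (V - {v})"
    have one: "card (fibre K ?S G) \<le> 1" for G
    proof -
      have "fibre K ?S G \<subseteq> {{v}}" by (auto simp: fibre_def)
      then show ?thesis using card_mono[of "{{v}}" "fibre K ?S G"] by simp
    qed
    have "fibre K ?S G = {}" if "G \<in> pairs (V - ?S)" for G
    proof (rule equals0I)
      fix A assume "A \<in> fibre K ?S G"
      then have "insert v G \<in> K" by (auto simp: fibre_def subset_singleton_iff)
      moreover have "finite G" "v \<notin> G" using that fin finite_subset[of G V] by auto
      ultimately show False using dim2[of "insert v G"] that by simp
    qed
    then have "card K \<le> card {F\<in>K. F \<inter> ?S = {}} + (1 + 1 * ?m + 0)"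
      using graph by (intro card_le_by_removing[OF fin KV _ dim] one) auto
    moreover have "card {F\<in>K. F \<inter> ?S = {}} \<le> box ?m" using graph by (intro rest) auto
    moreover have "?m + 1 = card V" using graph fin by (metis Suc_eq_plus1 card_Suc_Diff1)
    ultimately show ?thesis using box_add1[of ?m] by simp
  next
    case empty
    then have "K \<subseteq> {{}}" using KV by auto
    then have "card K \<le> 1" using card_mono[of "{{}}" K] by simp
    also have "\<dots> = box (card V)" using empty box_mod3(1)[of 0] by simp
    finally show ?thesis .
  qed
qed

section \<open>Small traces make a hereditary family cancellative\<close>

lemma subset_trace:
  "hereditary K \<Longrightarrow> C \<subseteq> K \<Longrightarrow> C \<subseteq> Pow Y \<Longrightarrow> C \<subseteq> trace K Y"
  by (force simp: trace_image)

text \<open>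
  The trace of a hereditary family contains all its members inside \<open>Y\<close>. Any four points of a member
  with more than three elements give 16 of them, and a violation of the cancellative condition gives 13.
\<close>

lemma hereditary_small_traces_cancellative:
  assumes fin: "finite V" and KV: "K \<subseteq> Pow V" and her: "hereditary K"
    and tr: "\<And>Y. Y \<subseteq> V \<Longrightarrow> card Y = 4 \<Longrightarrow> card (trace K Y) \<le> 12"
  shows "cancellative K"
  unfolding cancellative_def
proof (intro conjI ballI allI impI)
  have small: "card C \<le> 12" if "C \<subseteq> K" "C \<subseteq> Pow Y" "Y \<subseteq> V" "card Y = 4" for C Y
  proof -
    have "finite (trace K Y)" using fin KV by (simp add: trace_image finite_subset)
    then have "card C \<le> card (trace K Y)"
      using that subset_trace[OF her] by (metis card_mono)
    then show ?thesis using tr[OF that(3,4)] by simp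
  qed
  have down: "B \<in> K" if "A \<in> K" "B \<subseteq> A" for A B using that her by (auto simp: hereditary_def)
  show "hereditary K" by (rule her)
  show "card A \<le> 3" if A: "A \<in> K" for A
  proof (rule ccontr)
    assume "\<not> card A \<le> 3"
    then have "4 \<le> card A" by simp
    then obtain Y where Y: "Y \<subseteq> A" "card Y = 4" "finite Y"
      using obtain_subset_with_card_n by metis
    then have "card (Pow Y) \<le> 12" using A KV down by (intro small[of _ Y]) auto
    then show False using Y by (simp add: card_Pow)
  qed
  show "{u, v} \<notin> K" if uvG: "card G = 2 \<and> u \<notin> G \<and> v \<notin> G \<and> u \<noteq> v \<and> insert u G \<in> K \<and> insert v G \<in> K"
    for G u v
  proof
    assume uv: "{u, v} \<in> K"
    obtain a b where G: "G = {a, b}" "a \<noteq> b" using uvG by (auto simp: card_2_iff)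
    let ?Y = "{a, b, u, v}"
    have Y: "card ?Y = 4" using uvG G by auto
    \<comment> \<open>The two triples and the edge \<open>{u, v}\<close> contain all subsets of the four points but these three.\<close>
    let ?C = "Pow ?Y - {?Y, {a, u, v}, {b, u, v}}"
    have "?C \<subseteq> K"
    proof
      fix A assume A: "A \<in> ?C"
      have "A \<subseteq> insert u G \<or> A \<subseteq> insert v G \<or> A \<subseteq> {u, v}"
      proof (rule ccontr)
        assume neg: "\<not> (A \<subseteq> insert u G \<or> A \<subseteq> insert v G \<or> A \<subseteq> {u, v})"
        have "A \<subseteq> ?Y" using A by blast
        then have "v \<in> A" "u \<in> A" "a \<in> A \<or> b \<in> A" using neg unfolding G by blast+
        then have "A = ?Y \<or> A = {a, u, v} \<or> A = {b, u, v}" using \<open>A \<subseteq> ?Y\<close> by blast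
        then show False using A by blast
      qed
      then show "A \<in> K" using down uvG uv by blast
    qed
    moreover have "?Y \<subseteq> V" using uvG KV G by auto
    ultimately have "card ?C \<le> 12" using Y by (intro small[of _ ?Y]) auto
    moreover have "card (Pow ?Y) - card {?Y, {a, u, v}, {b, u, v}} \<le> card ?C"
      by (rule diff_card_le_card_Diff) simp
    moreover have "card {?Y, {a, u, v}, {b, u, v}} \<le> 3"
      by (simp add: card_insert_if)
    moreover have "card (Pow ?Y) = 16" using Y by (subst card_Pow) auto
    ultimately show False by linarith
  qed
qed

theorem theorem1p4:
  fixes n :: nat
  assumes "n \<ge> 25"
  shows "arrow n (1 + (\<Prod>i\<in>{0..<3}. (n + 3 + i) div 3)) 4 13"
  unfolding arrow_def
proof (intro allI impI)
  fix F :: "nat set set"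
  assume F: "F \<subseteq> Pow {1..n} \<and> 1 + (\<Prod>i\<in>{0..<3}. (n + 3 + i) div 3) \<le> card F"
  show "\<exists>Y\<subseteq>{1..n}. card Y = 4 \<and> 13 \<le> card (trace F Y)"
  proof (rule ccontr)
    assume none: "\<not> ?thesis"
    obtain K where K: "K \<subseteq> Pow {1..n}" "hereditary K" "card K = card F"
        "\<forall>Y. card (trace K Y) \<le> card (trace F Y)"
      using exists_hereditary_compression[of "{1..n}" F] F by auto
    have "card (trace K Y) \<le> 12" if "Y \<subseteq> {1..n}" "card Y = 4" for Y
    proof -
      have "card (trace F Y) < 13" using none that by (meson linorder_not_less)
      moreover have "card (trace K Y) \<le> card (trace F Y)" using K(4) by blast
      ultimately show ?thesis by linarith
    qed
    then have "cancellative K"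
      using K by (intro hereditary_small_traces_cancellative[of "{1..n}"]) auto
    then have "card K \<le> box n"
      using cancellative_card_le_box[of "{1..n}" K] K by simp
    then show False using F K(3) by (simp add: box_def)
  qed
qed

end
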